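(* Let $\mathcal{V}=\{1,\dots,N\}$ with $N\ge 2$, and let $\mathcal{Y}^{(t)}=\{y_i^{(t)}\mid i\in\mathcal{V}\}\subset\mathbb{R}^p$, $t\in\mathbb{N}$, be a sequence of point clouds in which each point converges in norm to some limit, i.e. there are $y_i\in\mathbb{R}^p$ with $\lim_{t\to\infty}\|y_i^{(t)}-y_i\|=0$ for each $i\in\mathcal{V}$. Let $\mathcal{Y}=\{y_i\mid i\in\mathcal{V}\}$ be the limiting point cloud. Assume that the neighbor orderings of $\mathcal{Y}$ and of each $\mathcal{Y}^{(t)}$ are well defined (for each fixed $i$, the distances from the $i$-th point to the points $j=1,\dots,N$ of the cloud are pairwise distinct). Then $\mathcal{Y}^{(t)}\to\mathcal{Y}$ globally in kNN topology, and there exists $t^*$ such that $F(\mathcal{Y}^{(t)})=F(\mathcal{Y})$ for every $t>t^*$, where $F$ is the kNN ordering function.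
   Context: For an enumerated point cloud $\mathcal{Y}=\{y_i\}_{i\in\mathcal{V}}\subset\mathbb{R}^p$, $\mathcal{V}=\{1,\dots,N\}$, let $f_{ij}(\mathcal{Y})=\|y_i-y_j\|_2$. The kNN ordering function $F$ assigns to $\mathcal{Y}$ the $N\times N$ matrix $F(\mathcal{Y})=[k_{ij}]$ with $k_{ii}=0$ and, for $j\neq i$, $k_{ij}$ the integer such that $y_j$ is the $k_{ij}$-th nearest neighbor of $y_i$; equivalently (when for each $i$ the values $f_{i1},\dots,f_{iN}$ are pairwise distinct) $k_{ij}=\#\{l\in\mathcal{V}:f_{il}<f_{ij}\}$. A sequence $\mathcal{Y}^{(t)}$ has global convergence in kNN topology to $\mathcal{Y}$ iff $\lim_{t\to\infty}F(\mathcal{Y}^{(t)})=F(\mathcal{Y})$, i.e. for every $\epsilon>0$ there exists $t^*$ such that $\max_{i,j}|F_{ij}(\mathcal{Y})-F_{ij}(\mathcal{Y}^{(t)})|<\epsilon$ for all $t>t^*$. *)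

theory Defs
  imports "HOL-Analysis.Analysis"
begin

text \<open>An enumerated point cloud with index set \<open>{1..N}\<close> is a function on \<open>nat\<close> of which only the
  values on \<open>{1..N}\<close> are used. Over \<open>real ^ 'p\<close> the norm below is the Euclidean one.\<close>

definition cloud_dist :: "(nat \<Rightarrow> 'a::real_normed_vector) \<Rightarrow> nat \<Rightarrow> nat \<Rightarrow> real" where
  "cloud_dist Y i j = norm (Y i - Y j)"

definition orderings_well_defined :: "nat \<Rightarrow> (nat \<Rightarrow> 'a::real_normed_vector) \<Rightarrow> bool" where
  "orderings_well_defined N Y \<longleftrightarrow> (\<forall>i\<in>{1..N}. inj_on (cloud_dist Y i) {1..N})"

text \<open>The other points, nearest first. A tie would be broken by index; this never happens when the
  orderings are well defined.\<close>

definition neighbours :: "nat \<Rightarrow> (nat \<Rightarrow> 'a::real_normed_vector) \<Rightarrow> nat \<Rightarrow> nat list" where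
  "neighbours N Y i = sort_key (cloud_dist Y i) (filter (\<lambda>j. j \<noteq> i) [1..<Suc N])"

definition is_kth_neighbour ::
    "nat \<Rightarrow> (nat \<Rightarrow> 'a::real_normed_vector) \<Rightarrow> nat \<Rightarrow> nat \<Rightarrow> nat \<Rightarrow> bool" where
  "is_kth_neighbour N Y i k j \<longleftrightarrow>
     1 \<le> k \<and> k \<le> length (neighbours N Y i) \<and> neighbours N Y i ! (k - 1) = j"

text \<open>The matrix is \<open>undefined\<close> outside \<open>{1..N} \<times> {1..N}\<close>, so that equality of two such functions is
  equality of \<open>N \<times> N\<close> matrices.\<close>

definition knn_ordering ::
    "nat \<Rightarrow> (nat \<Rightarrow> 'a::real_normed_vector) \<Rightarrow> nat \<times> nat \<Rightarrow> nat" where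
  "knn_ordering N Y = (\<lambda>(i, j) \<in> {1..N} \<times> {1..N}.
     if i = j then 0 else (THE k. is_kth_neighbour N Y i k j))"

definition knn_converges_globally ::
    "nat \<Rightarrow> (nat \<Rightarrow> nat \<Rightarrow> 'a::real_normed_vector) \<Rightarrow> (nat \<Rightarrow> 'a) \<Rightarrow> bool" where
  "knn_converges_globally N Ys Y \<longleftrightarrow>
     (\<forall>\<epsilon>>0. \<exists>t0. \<forall>t>t0.
        Max ((\<lambda>ij. \<bar>real (knn_ordering N Y ij) - real (knn_ordering N (Ys t) ij)\<bar>)
               ` ({1..N} \<times> {1..N})) < (\<epsilon>::real))"

lemma knn_ordering_eq_card:
  assumes wd: "orderings_well_defined N Y" and i: "i \<in> {1..N}" and j: "j \<in> {1..N}"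
  shows "knn_ordering N Y (i, j) = card {l \<in> {1..N}. cloud_dist Y i l < cloud_dist Y i j}"
proof (cases "i = j")
  case True
  then have "{l \<in> {1..N}. cloud_dist Y i l < cloud_dist Y i j} = {}"
    by (auto simp: cloud_dist_def)
  then show ?thesis using True i by (simp add: knn_ordering_def)
next
  case False
  define d where "d = cloud_dist Y i"
  define xs where "xs = neighbours N Y i"
  have inj: "inj_on d {1..N}" using wd i by (simp add: orderings_well_defined_def d_def)
  have set_xs: "set xs = {1..N} - {i}" by (auto simp: xs_def neighbours_def)
  have dist_xs: "distinct xs" by (simp add: xs_def neighbours_def)
  have "sorted (map d xs)" by (simp add: xs_def neighbours_def d_def)
  moreover have "distinct (map d xs)"
    using dist_xs inj set_xs by (simp add: distinct_map inj_on_diff)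
  ultimately have "sorted_wrt (<) (map d xs)" by (simp add: strict_sorted_iff)
  then have mono: "d (xs ! a) < d (xs ! b)" if "a < b" "b < length xs" for a b
    using that sorted_wrt_nth_less[of "(<)" "map d xs" a b] by simp
  have lt: "d (xs ! a) < d (xs ! b) \<longleftrightarrow> a < b" if "a < length xs" "b < length xs" for a b
    using mono[of a b] mono[of b a] that by (cases a b rule: linorder_cases) auto
  obtain m where m: "m < length xs" "xs ! m = j"
    using j False set_xs in_set_conv_nth[of j xs] by auto
  have the: "(THE k. is_kth_neighbour N Y i k j) = Suc m"
  proof (rule the_equality)
    show "is_kth_neighbour N Y i (Suc m) j"
      using m by (simp add: is_kth_neighbour_def flip: xs_def)
  next
    fix k assume "is_kth_neighbour N Y i k j"
    then have "1 \<le> k" "k \<le> length xs" "xs ! (k - 1) = j"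
      by (simp_all add: is_kth_neighbour_def flip: xs_def)
    then have "k - 1 = m"
      using m nth_eq_iff_index_eq[OF dist_xs, of "k - 1" m] by simp
    with \<open>1 \<le> k\<close> show "k = Suc m" by linarith
  qed
  have "d i = 0" by (simp add: d_def cloud_dist_def)
  moreover have "d j \<noteq> d i" using inj i j False by (auto dest: inj_onD)
  moreover have "d j \<ge> 0" by (simp add: d_def cloud_dist_def)
  ultimately have "d i < d j" by simp
  have "{l \<in> {1..N}. d l < d j} = insert i ((!) xs ` {..<m})"
  proof (intro equalityI subsetI)
    fix l assume l: "l \<in> {l \<in> {1..N}. d l < d j}"
    show "l \<in> insert i ((!) xs ` {..<m})"
    proof (cases "l = i")
      case False
      then obtain a where "a < length xs" "xs ! a = l"
        using l set_xs in_set_conv_nth[of l xs] by auto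
      then have "a < m" using l lt[of a m] m by simp
      then show ?thesis using \<open>xs ! a = l\<close> by auto
    qed simp
  next
    fix l assume "l \<in> insert i ((!) xs ` {..<m})"
    then consider "l = i" | a where "a < m" "l = xs ! a" by auto
    then show "l \<in> {l \<in> {1..N}. d l < d j}"
    proof cases
      case 1
      then show ?thesis using i \<open>d i < d j\<close> by simp
    next
      case 2
      then have "l \<in> set xs" "d l < d j" using m lt[of a m] by auto
      then show ?thesis using set_xs by simp
    qed
  qed
  moreover have "i \<notin> (!) xs ` {..<m}" using set_xs m nth_mem[of _ xs] by fastforce
  moreover have "card ((!) xs ` {..<m}) = m"
    using dist_xs m by (simp add: card_image inj_on_nth)
  ultimately have "card {l \<in> {1..N}. d l < d j} = Suc m" by simp
  then show ?thesis using the False i j by (simp add: knn_ordering_def d_def)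
qed

end

theory Submission
  imports Defs
begin

text \<open>Each comparison between two distances from a point is strict in the limit cloud, hence is
  eventually the same in the approximating clouds. There are finitely many comparisons, and the entries
  of the ordering matrix count them.\<close>

lemma tendsto_cloud_dist:
  assumes "((\<lambda>t. Ys t i) \<longlongrightarrow> Y i) F" and "((\<lambda>t. Ys t j) \<longlongrightarrow> Y j) F"
  shows "((\<lambda>t. cloud_dist (Ys t) i j) \<longlongrightarrow> cloud_dist Y i j) F"
  unfolding cloud_dist_def by (intro tendsto_intros assms)

text \<open>Disjoint open rays separate \<open>a\<close> from \<open>b\<close>; \<open>f\<close>
  eventually stays in the lower one and \<open>g\<close> in the upper one.\<close>

lemma tendsto_less_imp_eventually_less:
  fixes f g :: "'a \<Rightarrow> 'b::linorder_topology"
  assumes f: "(f \<longlongrightarrow> a) F" and g: "(g \<longlongrightarrow> b) F" and "a < b"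
  shows "\<forall>\<^sub>F t in F. f t < g t"
proof -
  \<comment> \<open>Two thresholds instead of one point between \<open>a\<close> and
    \<open>b\<close>, since the order may be non-dense and such a point need not exist.\<close>
  obtain u v where uv: "a < u" "v < b" "{..<u} \<inter> {v<..} = {}"
    using less_separate[OF \<open>a < b\<close>] by auto
  have "\<forall>\<^sub>F t in F. f t < u" "\<forall>\<^sub>F t in F. v < g t"
    using order_tendstoD f g uv by blast+
  \<comment> \<open>If \<open>g t \<le> f t\<close>, then \<open>v < g t < u\<close>, so
    \<open>g t\<close> would lie in both rays.\<close>
  then show ?thesis
    by eventually_elim (use uv(3) in fastforce)
qed

text \<open>For \<open>b < a\<close> the reverse strict inequality eventually holds, so both sides
  are false. Equal limits are excluded because the sign of the difference could then
  oscillate.\<close>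

lemma eventually_less_iff_less_limit:
  fixes f g :: "'a \<Rightarrow> 'b::linorder_topology"
  assumes f: "(f \<longlongrightarrow> a) F" and g: "(g \<longlongrightarrow> b) F" and "a \<noteq> b"
  shows "\<forall>\<^sub>F t in F. f t < g t \<longleftrightarrow> a < b"
proof (cases "a < b")
  case True
  then show ?thesis
    using tendsto_less_imp_eventually_less[OF f g] by (auto elim: eventually_mono)
next
  case False
  with \<open>a \<noteq> b\<close> have "b < a" by simp
  then show ?thesis
    using tendsto_less_imp_eventually_less[OF g f] by (auto elim!: eventually_mono)
qed

lemma eventually_cloud_dist_less_iff:
  assumes lim: "\<And>i. i \<in> {1..N} \<Longrightarrow> ((\<lambda>t. Ys t i) \<longlongrightarrow> Y i) F"
    and wd: "orderings_well_defined N Y"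
  shows "\<forall>\<^sub>F t in F. \<forall>i\<in>{1..N}. \<forall>j\<in>{1..N}. \<forall>l\<in>{1..N}.
           cloud_dist (Ys t) i l < cloud_dist (Ys t) i j \<longleftrightarrow> cloud_dist Y i l < cloud_dist Y i j"
proof (intro eventually_ball_finite ballI finite_atLeastAtMost)
  fix i j l assume i: "i \<in> {1..N}" and j: "j \<in> {1..N}" and l: "l \<in> {1..N}"
  show "\<forall>\<^sub>F t in F. cloud_dist (Ys t) i l < cloud_dist (Ys t) i j
          \<longleftrightarrow> cloud_dist Y i l < cloud_dist Y i j"
  \<comment> \<open>For \<open>l = j\<close> the limits coincide, but both comparisons are false by
    irreflexivity.\<close>
  proof (cases "l = j")
    case False
    then have "cloud_dist Y i l \<noteq> cloud_dist Y i j"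
      using wd i j l by (metis inj_onD orderings_well_defined_def)
    then show ?thesis
      using i j l by (intro eventually_less_iff_less_limit tendsto_cloud_dist lim)
  qed simp
qed

text \<open>By \<open>knn_ordering_eq_card\<close> each entry counts the points strictly closer than
  \<open>j\<close>, so it depends only on the truth values of these comparisons.\<close>

lemma knn_ordering_cong:
  assumes wd: "orderings_well_defined N X" "orderings_well_defined N Y"
    and less_iff: "\<And>i j l. \<lbrakk>i \<in> {1..N}; j \<in> {1..N}; l \<in> {1..N}\<rbrakk> \<Longrightarrow>
      cloud_dist X i l < cloud_dist X i j \<longleftrightarrow> cloud_dist Y i l < cloud_dist Y i j"
  shows "knn_ordering N X = knn_ordering N Y"
proof
  fix ij :: "nat \<times> nat"
  obtain i j where ij: "ij = (i, j)" by fastforce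
  show "knn_ordering N X ij = knn_ordering N Y ij"
  proof (cases "i \<in> {1..N} \<and> j \<in> {1..N}")
    case True
    then have "{l \<in> {1..N}. cloud_dist X i l < cloud_dist X i j}
        = {l \<in> {1..N}. cloud_dist Y i l < cloud_dist Y i j}"
      using less_iff by blast
    with True show ?thesis by (simp only: ij knn_ordering_eq_card wd)
  next
    case False
    \<comment> \<open>Outside the index square both functions are \<open>undefined\<close>.\<close>
    then show ?thesis by (auto simp: ij knn_ordering_def)
  qed
qed

lemma knn_converges_globallyI:
  assumes "N \<ge> 1" and eq: "\<And>t. t > t0 \<Longrightarrow> knn_ordering N (Ys t) = knn_ordering N Y"
  shows "knn_converges_globally N Ys Y"
proof -
  \<comment> \<open>Nonemptiness makes the \<open>Max\<close> of the constantly zero differences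
    equal to 0; the same \<open>t0\<close> then serves every \<epsilon>.\<close>
  have "{1..N} \<times> {1..N} \<noteq> {}" using \<open>N \<ge> 1\<close> by simp
  then show ?thesis
    unfolding knn_converges_globally_def using eq by (auto intro!: exI[of _ t0])
qed

theorem theorem3p16:
  fixes N :: nat
    and Ys :: "nat \<Rightarrow> nat \<Rightarrow> real ^ 'p"
    and Y :: "nat \<Rightarrow> real ^ 'p"
  assumes "N \<ge> 2"
    and "\<And>i. i \<in> {1..N} \<Longrightarrow> (\<lambda>t. norm (Ys t i - Y i)) \<longlonglongrightarrow> 0"
    and "orderings_well_defined N Y"
    and "\<And>t. orderings_well_defined N (Ys t)"
  shows "knn_converges_globally N Ys Y \<and>
         (\<exists>t0. \<forall>t>t0. knn_ordering N (Ys t) = knn_ordering N Y)"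
proof -
  have "(\<lambda>t. Ys t i) \<longlonglongrightarrow> Y i" if "i \<in> {1..N}" for i
    using assms(2)[OF that] by (simp add: tendsto_norm_zero_iff LIM_zero_iff)
  then have "\<forall>\<^sub>F t in sequentially. knn_ordering N (Ys t) = knn_ordering N Y"
    using eventually_cloud_dist_less_iff[of N Ys Y sequentially] assms(3,4)
    by (auto elim!: eventually_mono intro: knn_ordering_cong)
  \<comment> \<open>\<open>eventually_at_top_dense\<close> yields the strict bound
    \<open>t > t0\<close> that both conclusions use.\<close>
  then obtain t0 where "\<And>t. t > t0 \<Longrightarrow> knn_ordering N (Ys t) = knn_ordering N Y"
    by (auto simp: eventually_at_top_dense)
  moreover from this have "knn_converges_globally N Ys Y"
    using \<open>N \<ge> 2\<close> by (intro knn_converges_globallyI) auto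
  ultimately show ?thesis by blast
qed

end
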